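(* Let $X$ be an $n$-pseudomanifold such that $H^{n-1}(X;\mathbb{Z}_2)=0$. Then $$h^{n-1}(X)=\frac{2}{\operatorname{diam}(G_X)}.$$
   Context: An $n$-pseudomanifold is a finite pure $n$-dimensional simplicial complex in which every $(n-1)$-simplex lies in exactly two $n$-simplices and whose flip graph is connected. The flip graph $G_X$ has vertex set $X(n)$ and edges $\{\sigma,\sigma'\}$ with $\dim(\sigma\cap\sigma')=n-1$; $\operatorname{diam}$ is graph diameter. Cochains have $\mathbb{Z}_2$ coefficients; $\|\phi\|$ is the size of the support of $\phi$, $\|\phi\|_{csy}=\min_{\psi\in C^{k-1}(X)}\|\phi+d_{k-1}\psi\|$, and $h^k(X)=\min\{\|d_k\phi\|/\|\phi\|_{csy}:\phi\in C^k(X)\setminus B^k(X)\}$, where $B^k(X)=d_{k-1}C^{k-1}(X)$. *)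

theory Defs
  imports
    "HOL-Library.Z2"
    "HOL-Algebra.Coset"
    "HOL-Algebra.Elementary_Groups"
    "Graph_Theory.Digraph_Component"
    "Graph_Theory.Shortest_Path"
begin

section \<open>Simplicial complexes\<close>

text \<open>
  Complexes are abstract, and the empty set is a simplex, of dimension \<open>-1\<close>.  Dimensions are
  therefore integers.
\<close>

definition simplicial_complex :: "'a set set \<Rightarrow> bool" where
  "simplicial_complex X \<longleftrightarrow>
     X \<noteq> {} \<and> (\<forall>\<sigma>\<in>X. finite \<sigma>) \<and> (\<forall>\<sigma>\<in>X. \<forall>\<tau>. \<tau> \<subseteq> \<sigma> \<longrightarrow> \<tau> \<in> X)"

definition simplex_dim :: "'a set \<Rightarrow> int" where
  "simplex_dim \<sigma> = int (card \<sigma>) - 1"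

definition simplices :: "'a set set \<Rightarrow> int \<Rightarrow> 'a set set" where
  "simplices X k = {\<sigma> \<in> X. simplex_dim \<sigma> = k}"

definition pure_complex :: "nat \<Rightarrow> 'a set set \<Rightarrow> bool" where
  "pure_complex n X \<longleftrightarrow>
     simplicial_complex X \<and> (\<forall>\<tau>\<in>X. \<exists>\<sigma>\<in>simplices X (int n). \<tau> \<subseteq> \<sigma>)"

section \<open>The flip graph and its diameter\<close>

text \<open>An undirected edge is represented by its two orientations.\<close>

definition flip_graph :: "nat \<Rightarrow> 'a set set \<Rightarrow> 'a set pair_pre_digraph" where
  "flip_graph n X =
     \<lparr> pverts = simplices X (int n),
       parcs = {(\<sigma>, \<sigma>'). \<sigma> \<in> simplices X (int n) \<and> \<sigma>' \<in> simplices X (int n) \<and>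
                         simplex_dim (\<sigma> \<inter> \<sigma>') = int n - 1} \<rparr>"

text \<open>With unit weights, \<open>wf_digraph.\<mu>\<close> is the number of arcs of a shortest walk.\<close>

definition graph_diameter :: "('a, 'b) pre_digraph \<Rightarrow> ereal" where
  "graph_diameter G = (SUP u\<in>verts G. SUP v\<in>verts G. wf_digraph.\<mu> G (\<lambda>_. 1) u v)"

definition pseudomanifold :: "nat \<Rightarrow> 'a set set \<Rightarrow> bool" where
  "pseudomanifold n X \<longleftrightarrow>
     finite X \<and> pure_complex n X \<and>
     (\<forall>\<tau>\<in>simplices X (int n - 1). card {\<sigma> \<in> simplices X (int n). \<tau> \<subseteq> \<sigma>} = 2) \<and>
     Digraph_Component.connected (with_proj (flip_graph n X))"

section \<open>Cochains and cohomology with coefficients in the field of two elements\<close>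

text \<open>
  A cochain is extended by zero to all sets, so that equal cochains are equal functions.
  As the empty set is a simplex, the cochain complex is the augmented one: the nonzero element
  of \<open>coboundaries X 0\<close> is the all-ones function on the vertices, and \<open>cohomology X 0\<close> is
  reduced cohomology.  In positive degrees there is no difference to the unaugmented complex.
\<close>

definition cochains :: "'a set set \<Rightarrow> int \<Rightarrow> ('a set \<Rightarrow> bit) set" where
  "cochains X k = {\<phi>. \<forall>\<sigma>. \<sigma> \<notin> simplices X k \<longrightarrow> \<phi> \<sigma> = 0}"

definition coboundary :: "'a set set \<Rightarrow> int \<Rightarrow> ('a set \<Rightarrow> bit) \<Rightarrow> 'a set \<Rightarrow> bit" where
  "coboundary X k \<phi> =
     (\<lambda>\<sigma>. if \<sigma> \<in> simplices X (k + 1) then \<Sum>\<tau> | \<tau> \<in> simplices X k \<and> \<tau> \<subseteq> \<sigma>. \<phi> \<tau> else 0)"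

definition coboundaries :: "'a set set \<Rightarrow> int \<Rightarrow> ('a set \<Rightarrow> bit) set" where
  "coboundaries X k = coboundary X (k - 1) ` cochains X (k - 1)"

definition cocycle_group :: "'a set set \<Rightarrow> int \<Rightarrow> ('a set \<Rightarrow> bit) monoid" where
  "cocycle_group X k =
     \<lparr> carrier = {\<phi> \<in> cochains X k. coboundary X k \<phi> = (\<lambda>_. 0)},
       monoid.mult = (\<lambda>\<phi> \<psi> \<sigma>. \<phi> \<sigma> + \<psi> \<sigma>),
       monoid.one = (\<lambda>_. 0) \<rparr>"

definition cohomology :: "'a set set \<Rightarrow> int \<Rightarrow> ('a set \<Rightarrow> bit) set monoid" where
  "cohomology X k = cocycle_group X k Mod coboundaries X k"

section \<open>Coboundary expansion\<close>

definition cochain_norm :: "('a set \<Rightarrow> bit) \<Rightarrow> nat" where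
  "cochain_norm \<phi> = card {\<sigma>. \<phi> \<sigma> \<noteq> 0}"

definition csy_norm :: "'a set set \<Rightarrow> int \<Rightarrow> ('a set \<Rightarrow> bit) \<Rightarrow> nat" where
  "csy_norm X k \<phi> =
     Min ((\<lambda>\<psi>. cochain_norm (\<lambda>\<sigma>. \<phi> \<sigma> + coboundary X (k - 1) \<psi> \<sigma>)) ` cochains X (k - 1))"

text \<open>
  For finite \<open>X\<close> both minima range over finite sets; the one below is meaningful only if
  some \<open>k\<close>-cochain is not a coboundary.
\<close>

definition coboundary_expansion :: "'a set set \<Rightarrow> int \<Rightarrow> real" where
  "coboundary_expansion X k =
     Min ((\<lambda>\<phi>. real (cochain_norm (coboundary X k \<phi>)) / real (csy_norm X k \<phi>))
           ` (cochains X k - coboundaries X k))"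

end

theory Submission
  imports Defs
begin

text \<open>
  An \<open>(n - 1)\<close>-cochain is a set of edges of the flip graph, and its coboundary is the set of
  vertices of odd degree.  As the cohomology vanishes, the cocycles are the coboundaries, so the
  cosystolic norm of \<open>\<phi>\<close> is the least size of a \<open>T\<close>-join, where \<open>T\<close> is the support of \<open>d \<phi>\<close>.
  Pairing up the elements of \<open>T\<close> by shortest walks gives a \<open>T\<close>-join with at most
  \<open>card T / 2 * diam\<close> edges, so every quotient is at least \<open>2 / diam\<close>.  If \<open>T\<close> consists of two
  vertices at distance \<open>diam\<close>, then every \<open>T\<close>-join has an edge between any two consecutive
  distance levels, hence at least \<open>diam\<close> edges, and the quotient is at most \<open>2 / diam\<close>.
\<close>

(* The simplifier would otherwise rewrite sums of bits to bitwise operations. *)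
declare add_bit_eq_xor [simp del] mult_bit_eq_and [simp del]

section \<open>Arithmetic in the field of two elements\<close>

lemma bit_add_self [simp]: "(a :: bit) + a = 0"
  by (cases a) auto

lemma bit_add_self_left [simp]: "(a :: bit) + (a + b) = b"
  by (simp flip: add.assoc)

lemma bit_add_eq_0_iff: "(a :: bit) + b = 0 \<longleftrightarrow> a = b"
  by (cases a; cases b) auto

text \<open>Each summand is the indicator of its own nonvanishing. This turns the parity of a
  support into a sum of bits.\<close>

lemma sum_bit_eq_of_nat_card:
  "finite A \<Longrightarrow> (\<Sum>x\<in>A. g x :: bit) = of_nat (card {x \<in> A. g x \<noteq> 0})"
proof -
  assume "finite A"
  have "(\<Sum>x\<in>A. g x) = (\<Sum>x\<in>A. of_bool (g x \<noteq> 0))"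
    by (intro sum.cong) auto
  also have "\<dots> = of_nat (card {x \<in> A. g x \<noteq> 0})"
    using \<open>finite A\<close> by (simp add: Int_def)
  finally show ?thesis .
qed

lemma of_nat_bit_eq_0_iff: "(of_nat m :: bit) = 0 \<longleftrightarrow> even m"
  by (metis even_of_nat even_zero bit_not_zero_iff odd_one)

section \<open>Hop distance in a directed graph\<close>

context wf_digraph
begin

text \<open>A natural-number version of the unit-weight distance \<open>\<mu>\<close>, suited to
  arguments by levels. The value is unspecified if no walk exists, hence the reachability hypotheses
  in the lemmas below.\<close>

definition hop_dist :: "'a \<Rightarrow> 'a \<Rightarrow> nat" where
  "hop_dist u v = (LEAST k. \<exists>p. awalk u p v \<and> length p = k)"

lemma awalk_cost_one: "awalk_cost (\<lambda>_. 1) p = real (length p)"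
  by (induction p) auto

lemma hop_dist_le: "awalk u p v \<Longrightarrow> hop_dist u v \<le> length p"
  unfolding hop_dist_def by (rule Least_le) auto

lemma shortest_awalk:
  assumes "u \<rightarrow>\<^sup>* v"
  obtains p where "awalk u p v" "length p = hop_dist u v"
proof -
  have "\<exists>k p. awalk u p v \<and> length p = k"
    using assms by (auto simp: reachable_awalk)
  then have "\<exists>p. awalk u p v \<and> length p = hop_dist u v"
    unfolding hop_dist_def by (rule LeastI_ex)
  then show ?thesis
    using that by blast
qed

text \<open>The infimum over all walks is attained by a walk of least length. This links the
  extended-real diameter to natural numbers.\<close>

lemma \<mu>_one_eq_hop_dist:
  assumes "u \<rightarrow>\<^sup>* v"
  shows "\<mu> (\<lambda>_. 1) u v = ereal (real (hop_dist u v))"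
proof (rule antisym)
  obtain p where "awalk u p v" "length p = hop_dist u v"
    using assms by (rule shortest_awalk)
  then show "\<mu> (\<lambda>_. 1) u v \<le> ereal (real (hop_dist u v))"
    using min_cost_le_walk_cost[of u p v "\<lambda>_. 1"] by (simp add: awalk_cost_one)
  show "ereal (real (hop_dist u v)) \<le> \<mu> (\<lambda>_. 1) u v"
    unfolding \<mu>_def by (rule INF_greatest) (auto simp: awalk_cost_one hop_dist_le)
qed

lemma hop_dist_self [simp]: "u \<in> verts G \<Longrightarrow> hop_dist u u = 0"
  using hop_dist_le[of u "[]" u] by (simp add: awalk_Nil_iff)

lemma hop_dist_eq_0_imp_eq:
  assumes "u \<rightarrow>\<^sup>* v" "hop_dist u v = 0"
  shows "u = v"
proof -
  obtain p where "awalk u p v" "length p = hop_dist u v"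
    using assms(1) by (rule shortest_awalk)
  then show ?thesis
    using assms(2) by (simp add: awalk_Nil_iff)
qed

text \<open>Appending the arc to a shortest walk to its tail gives a walk to its head. Hence an arc
  climbs at most one distance level.\<close>

lemma hop_dist_arc:
  assumes "u \<rightarrow>\<^sup>* v" "e \<in> arcs G" "tail G e = v" "head G e = w"
  shows "hop_dist u w \<le> Suc (hop_dist u v)"
proof -
  obtain p where p: "awalk u p v" "length p = hop_dist u v"
    using assms(1) by (rule shortest_awalk)
  have "awalk v [e] w"
    using assms by (auto simp: awalk_simps)
  then have "awalk u (p @ [e]) w"
    using p(1) by (rule awalk_appendI[rotated])
  from hop_dist_le[OF this] p(2) show ?thesis
    by simp
qed

end

section \<open>Cochains\<close>

text \<open>An intermediate set adds to \<open>\<rho>\<close> one of the two elements of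
  \<open>\<sigma> - \<rho>\<close>. This count is behind the vanishing of the squared
  coboundary.\<close>

lemma card_between_codim_2:
  assumes "finite \<sigma>" "\<rho> \<subseteq> \<sigma>" "card \<sigma> = card \<rho> + 2"
  shows "card {\<tau>. \<rho> \<subseteq> \<tau> \<and> \<tau> \<subseteq> \<sigma> \<and> card \<tau> = card \<rho> + 1} = 2"
proof -
  have fin: "finite \<rho>"
    using assms finite_subset by blast
  have "{\<tau>. \<rho> \<subseteq> \<tau> \<and> \<tau> \<subseteq> \<sigma> \<and> card \<tau> = card \<rho> + 1} = (\<lambda>a. insert a \<rho>) ` (\<sigma> - \<rho>)"
  proof (intro equalityI subsetI)
    fix \<tau> assume \<tau>: "\<tau> \<in> {\<tau>. \<rho> \<subseteq> \<tau> \<and> \<tau> \<subseteq> \<sigma> \<and> card \<tau> = card \<rho> + 1}"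
    then have "card (\<tau> - \<rho>) = 1"
      using fin by (simp add: card_Diff_subset)
    then obtain a where "\<tau> - \<rho> = {a}"
      by (auto simp: card_1_singleton_iff)
    with \<tau> have "\<tau> = insert a \<rho>" "a \<in> \<sigma> - \<rho>"
      by auto
    then show "\<tau> \<in> (\<lambda>a. insert a \<rho>) ` (\<sigma> - \<rho>)"
      by blast
  qed (use assms fin in auto)
  moreover have "inj_on (\<lambda>a. insert a \<rho>) (\<sigma> - \<rho>)"
    by (auto simp: inj_on_def)
  moreover have "card (\<sigma> - \<rho>) = 2"
    using assms fin by (simp add: card_Diff_subset)
  ultimately show ?thesis
    by (simp add: card_image)
qed

lemma finite_simplices: "finite X \<Longrightarrow> finite (simplices X k)"
  by (simp add: simplices_def)

lemma simplicesD:
  "\<sigma> \<in> simplices X k \<Longrightarrow> \<sigma> \<in> X"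
  "\<sigma> \<in> simplices X k \<Longrightarrow> int (card \<sigma>) = k + 1"
  by (auto simp: simplices_def simplex_dim_def)

lemma simplices_face:
  "simplicial_complex X \<Longrightarrow> \<sigma> \<in> X \<Longrightarrow> \<tau> \<subseteq> \<sigma> \<Longrightarrow> int (card \<tau>) = k + 1 \<Longrightarrow> \<tau> \<in> simplices X k"
  by (auto simp: simplices_def simplex_dim_def simplicial_complex_def)

lemma simplex_finite: "simplicial_complex X \<Longrightarrow> \<sigma> \<in> X \<Longrightarrow> finite \<sigma>"
  by (auto simp: simplicial_complex_def)

lemma cochains_zero: "(\<lambda>_. 0) \<in> cochains X k"
  by (simp add: cochains_def)

lemma cochains_add: "\<phi> \<in> cochains X k \<Longrightarrow> \<psi> \<in> cochains X k \<Longrightarrow> (\<lambda>\<sigma>. \<phi> \<sigma> + \<psi> \<sigma>) \<in> cochains X k"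
  by (simp add: cochains_def)

lemma coboundary_in_cochains: "coboundary X (k - 1) \<phi> \<in> cochains X k"
  by (simp add: cochains_def coboundary_def)

lemma cochain_support_subset: "\<phi> \<in> cochains X k \<Longrightarrow> {\<sigma>. \<phi> \<sigma> \<noteq> 0} \<subseteq> simplices X k"
  by (auto simp: cochains_def)

lemma finite_cochain_support:
  "finite X \<Longrightarrow> \<phi> \<in> cochains X k \<Longrightarrow> finite {\<sigma>. \<phi> \<sigma> \<noteq> 0}"
  using finite_subset[OF cochain_support_subset finite_simplices] .

text \<open>A cochain of bits is determined by its support, a subset of a finite set. This makes the
  uses of \<open>Min\<close> in the definitions meaningful.\<close>

lemma finite_cochains:
  assumes "finite X"
  shows "finite (cochains X k)"
proof (rule inj_on_finite)
  show "inj_on (\<lambda>\<phi>. {\<sigma>. \<phi> \<sigma> \<noteq> 0}) (cochains X k)"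
  proof (rule inj_onI)
    fix \<phi> \<psi> :: "'a set \<Rightarrow> bit"
    assume "{\<sigma>. \<phi> \<sigma> \<noteq> 0} = {\<sigma>. \<psi> \<sigma> \<noteq> 0}"
    then have "\<phi> \<sigma> \<noteq> 0 \<longleftrightarrow> \<psi> \<sigma> \<noteq> 0" for \<sigma>
      by blast
    then show "\<phi> = \<psi>"
      by (metis bit_not_zero_iff ext)
  qed
  show "(\<lambda>\<phi>. {\<sigma>. \<phi> \<sigma> \<noteq> 0}) ` cochains X k \<subseteq> Pow (simplices X k)"
    using cochain_support_subset by blast
  show "finite (Pow (simplices X k))"
    using assms by (simp add: finite_simplices)
qed

lemma cochain_norm_add_le:
  assumes "finite X" "\<phi> \<in> cochains X k" "\<psi> \<in> cochains X k"
  shows "cochain_norm (\<lambda>\<sigma>. \<phi> \<sigma> + \<psi> \<sigma>) \<le> cochain_norm \<phi> + cochain_norm \<psi>"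
proof -
  have "card {\<sigma>. \<phi> \<sigma> + \<psi> \<sigma> \<noteq> 0} \<le> card ({\<sigma>. \<phi> \<sigma> \<noteq> 0} \<union> {\<sigma>. \<psi> \<sigma> \<noteq> 0})"
    using finite_cochain_support[OF assms(1)] assms(2,3)
    by (intro card_mono finite_UnI) auto
  also have "\<dots> \<le> card {\<sigma>. \<phi> \<sigma> \<noteq> 0} + card {\<sigma>. \<psi> \<sigma> \<noteq> 0}"
    by (rule card_Un_le)
  finally show ?thesis
    by (simp add: cochain_norm_def)
qed

lemma cochain_norm_eq_0_iff:
  "finite X \<Longrightarrow> \<phi> \<in> cochains X k \<Longrightarrow> cochain_norm \<phi> = 0 \<longleftrightarrow> \<phi> = (\<lambda>_. 0)"
  using finite_cochain_support[of X \<phi> k] by (auto simp: cochain_norm_def)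

section \<open>The coboundary operator, its square, and vanishing cohomology\<close>

lemma coboundary_add:
  "coboundary X k (\<lambda>\<tau>. \<phi> \<tau> + \<psi> \<tau>) = (\<lambda>\<sigma>. coboundary X k \<phi> \<sigma> + coboundary X k \<psi> \<sigma>)"
  by (auto simp: coboundary_def sum.distrib)

lemma coboundary_zero: "coboundary X k (\<lambda>_. 0) = (\<lambda>_. 0)"
  by (auto simp: coboundary_def)

text \<open>After exchanging the sums, \<open>\<phi> \<rho>\<close> is counted once for every
  simplex strictly between \<open>\<rho>\<close> and \<open>\<sigma>\<close>. There are two of these
  or none, so everything cancels modulo 2.\<close>

lemma coboundary_coboundary:
  assumes "finite X" "simplicial_complex X"
  shows "coboundary X (k + 1) (coboundary X k \<phi>) = (\<lambda>_. 0)"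
proof
  fix \<sigma>
  show "coboundary X (k + 1) (coboundary X k \<phi>) \<sigma> = 0"
  proof (cases "\<sigma> \<in> simplices X (k + 1 + 1)")
    case True
    then have \<sigma>: "\<sigma> \<in> X" "finite \<sigma>" "int (card \<sigma>) = k + 3"
      using simplicesD[OF True] simplex_finite[OF assms(2)] by auto
    let ?T = "{\<tau>. \<tau> \<in> simplices X (k + 1) \<and> \<tau> \<subseteq> \<sigma>}"
    have *: "(\<Sum>\<tau> | \<tau> \<in> ?T \<and> \<rho> \<subseteq> \<tau>. \<phi> \<rho>) = 0" if \<rho>: "\<rho> \<in> simplices X k" for \<rho>
    proof (cases "\<rho> \<subseteq> \<sigma>")
      case True
      have "{\<tau>. \<tau> \<in> ?T \<and> \<rho> \<subseteq> \<tau>} = {\<tau>. \<rho> \<subseteq> \<tau> \<and> \<tau> \<subseteq> \<sigma> \<and> card \<tau> = card \<rho> + 1}"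
        using simplicesD(2)[OF \<rho>] simplices_face[OF assms(2) \<sigma>(1)] simplicesD(2) by fastforce
      then have "card {\<tau>. \<tau> \<in> ?T \<and> \<rho> \<subseteq> \<tau>} = 2"
        using card_between_codim_2[OF \<sigma>(2) True] simplicesD(2)[OF \<rho>] \<sigma>(3) by simp
      \<comment> \<open>The summand does not depend on \<open>\<tau>\<close>, so the sum is
        \<open>\<phi> \<rho>\<close> taken twice.\<close>
      then show ?thesis
        by simp
    next
      case False
      then have "{\<tau>. \<tau> \<in> ?T \<and> \<rho> \<subseteq> \<tau>} = {}"
        by blast
      then show ?thesis
        by (simp only: sum.empty)
    qed
    have "coboundary X (k + 1) (coboundary X k \<phi>) \<sigma>
        = (\<Sum>\<tau>\<in>?T. \<Sum>\<rho> | \<rho> \<in> simplices X k \<and> \<rho> \<subseteq> \<tau>. \<phi> \<rho>)"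
      using True by (simp add: coboundary_def)
    also have "\<dots> = (\<Sum>\<rho>\<in>simplices X k. \<Sum>\<tau> | \<tau> \<in> ?T \<and> \<rho> \<subseteq> \<tau>. \<phi> \<rho>)"
      using assms(1) by (intro sum.swap_restrict) (auto simp: finite_simplices)
    also have "\<dots> = 0"
      by (rule sum.neutral) (use * in blast)
    finally show ?thesis .
  qed (simp add: coboundary_def)
qed

lemma coboundary_of_coboundaries:
  assumes "finite X" "simplicial_complex X" "\<phi> \<in> coboundaries X k"
  shows "coboundary X k \<phi> = (\<lambda>_. 0)"
  using assms(3) coboundary_coboundary[OF assms(1,2), of "k - 1"] by (auto simp: coboundaries_def)

lemma zero_in_coboundaries: "(\<lambda>_. 0) \<in> coboundaries X k"
  unfolding coboundaries_def using cochains_zero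
  by (rule rev_image_eqI) (simp only: coboundary_zero)

text \<open>The only element of a trivial quotient is its unit, the coset
  \<open>coboundaries X k\<close>. The coset of \<open>\<phi>\<close> therefore equals it, and
  contains \<open>\<phi>\<close> because zero is a coboundary.\<close>

lemma cocycle_in_coboundaries:
  assumes "trivial_group (cohomology X k)" "\<phi> \<in> cochains X k" "coboundary X k \<phi> = (\<lambda>_. 0)"
  shows "\<phi> \<in> coboundaries X k"
proof -
  have "\<phi> \<in> carrier (cocycle_group X k)"
    using assms by (simp add: cocycle_group_def)
  then have "coboundaries X k #>\<^bsub>cocycle_group X k\<^esub> \<phi> \<in> carrier (cohomology X k)"
    by (auto simp: cohomology_def FactGroup_def RCOSETS_def)
  then have "coboundaries X k #>\<^bsub>cocycle_group X k\<^esub> \<phi> = coboundaries X k"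
    using assms(1) by (auto simp: trivial_group_def cohomology_def FactGroup_def)
  moreover have "\<phi> \<in> coboundaries X k #>\<^bsub>cocycle_group X k\<^esub> \<phi>"
    using zero_in_coboundaries[of X k] by (force simp: r_coset_def cocycle_group_def)
  ultimately show ?thesis
    by simp
qed

section \<open>The cosystolic norm\<close>

lemma csy_norm_le:
  "finite X \<Longrightarrow> \<psi> \<in> cochains X (k - 1) \<Longrightarrow>
    csy_norm X k \<phi> \<le> cochain_norm (\<lambda>\<sigma>. \<phi> \<sigma> + coboundary X (k - 1) \<psi> \<sigma>)"
  unfolding csy_norm_def by (intro Min_le) (auto simp: finite_cochains)

lemma csy_norm_attained:
  assumes "finite X"
  obtains \<psi> where "\<psi> \<in> cochains X (k - 1)"
    "csy_norm X k \<phi> = cochain_norm (\<lambda>\<sigma>. \<phi> \<sigma> + coboundary X (k - 1) \<psi> \<sigma>)"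
proof -
  have "csy_norm X k \<phi> \<in>
      (\<lambda>\<psi>. cochain_norm (\<lambda>\<sigma>. \<phi> \<sigma> + coboundary X (k - 1) \<psi> \<sigma>)) ` cochains X (k - 1)"
    unfolding csy_norm_def using assms cochains_zero
    by (intro Min_in) (auto simp: finite_cochains)
  then show ?thesis
    using that by auto
qed

text \<open>Norm zero would mean \<open>\<phi> + d \<psi> = 0\<close> for some
  \<open>\<psi>\<close>, which modulo 2 says \<open>\<phi> = d \<psi>\<close>. So no quotient in the
  expansion constant divides by zero.\<close>

lemma csy_norm_pos:
  assumes "finite X" "\<phi> \<in> cochains X k" "\<phi> \<notin> coboundaries X k"
  shows "csy_norm X k \<phi> > 0"
proof (rule ccontr)
  assume "\<not> csy_norm X k \<phi> > 0"
  obtain \<psi> where \<psi>: "\<psi> \<in> cochains X (k - 1)"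
      "csy_norm X k \<phi> = cochain_norm (\<lambda>\<sigma>. \<phi> \<sigma> + coboundary X (k - 1) \<psi> \<sigma>)"
    using csy_norm_attained[OF assms(1)] .
  then have "cochain_norm (\<lambda>\<sigma>. \<phi> \<sigma> + coboundary X (k - 1) \<psi> \<sigma>) = 0"
    using \<open>\<not> csy_norm X k \<phi> > 0\<close> by simp
  then have "(\<lambda>\<sigma>. \<phi> \<sigma> + coboundary X (k - 1) \<psi> \<sigma>) = (\<lambda>_. 0)"
    by (simp only: cochain_norm_eq_0_iff[OF assms(1) cochains_add[OF assms(2) coboundary_in_cochains]])
  then have "\<phi> = coboundary X (k - 1) \<psi>"
    by (simp add: fun_eq_iff bit_add_eq_0_iff)
  then show False
    using \<psi>(1) assms(3) by (auto simp: coboundaries_def)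
qed

section \<open>Pseudomanifolds\<close>

locale pseudomanifold_complex =
  fixes n :: nat and X :: "'a set set"
  assumes pseudomanifold: "pseudomanifold n X"
begin

abbreviation facets :: "'a set set" where
  "facets \<equiv> simplices X (int n)"

abbreviation ridges :: "'a set set" where
  "ridges \<equiv> simplices X (int n - 1)"

abbreviation cofacets :: "'a set \<Rightarrow> 'a set set" where
  "cofacets \<tau> \<equiv> {\<sigma> \<in> facets. \<tau> \<subseteq> \<sigma>}"

abbreviation \<delta> :: "('a set \<Rightarrow> bit) \<Rightarrow> 'a set \<Rightarrow> bit" where
  "\<delta> \<equiv> coboundary X (int n - 1)"

section \<open>Facets, ridges and the flip graph\<close>

lemma finite_X: "finite X"
  and complex: "simplicial_complex X"
  and pure: "\<tau> \<in> X \<Longrightarrow> \<exists>\<sigma>\<in>facets. \<tau> \<subseteq> \<sigma>"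
  and card_cofacets: "\<tau> \<in> ridges \<Longrightarrow> card (cofacets \<tau>) = 2"
  using pseudomanifold by (auto simp: pseudomanifold_def pure_complex_def)

lemma facet_finite: "\<sigma> \<in> facets \<Longrightarrow> finite \<sigma>"
  and card_facet: "\<sigma> \<in> facets \<Longrightarrow> card \<sigma> = Suc n"
  using simplicesD[of \<sigma> X "int n"] simplex_finite[OF complex] by auto

lemma card_ridge: "\<tau> \<in> ridges \<Longrightarrow> card \<tau> = n"
  using simplicesD[of \<tau> X "int n - 1"] by auto

lemma pverts_flip_graph [simp]: "pverts (flip_graph n X) = facets"
  by (simp add: flip_graph_def)

lemma flip_arc_iff:
  "(\<sigma>, \<sigma>') \<in> parcs (flip_graph n X) \<longleftrightarrow>
    \<sigma> \<in> facets \<and> \<sigma>' \<in> facets \<and> card (\<sigma> \<inter> \<sigma>') = n"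
  by (auto simp: flip_graph_def simplex_dim_def)

sublocale flip: pair_wf_digraph "flip_graph n X"
  by unfold_locales (auto simp: flip_arc_iff)

text \<open>Connectedness is defined through the symmetric closure. The flip graph has both
  orientations of each edge, so it is strongly connected and every distance is realised by a
  walk.\<close>

lemma flip_reachable:
  assumes "u \<in> facets" "v \<in> facets"
  shows "u \<rightarrow>\<^sup>*\<^bsub>with_proj (flip_graph n X)\<^esub> v"
proof -
  have "symmetric (with_proj (flip_graph n X))"
    by (auto simp: symmetric_def sym_def flip_arc_iff Int_commute)
  then have "strongly_connected (with_proj (flip_graph n X))"
    using pseudomanifold flip.symmetric_connected_imp_strongly_connected
    by (auto simp: pseudomanifold_def)
  then show ?thesis
    using assms by (auto simp: strongly_connected_def)
qed

text \<open>The intersection is a ridge with exactly two cofacets, and the two distinct ends of the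
  arc already are such. Together with \<open>ridge_cofacets\<close> this identifies edges of the
  flip graph with ridges.\<close>

lemma cofacets_Int:
  assumes "(\<sigma>, \<sigma>') \<in> parcs (flip_graph n X)"
  shows "\<sigma> \<noteq> \<sigma>'" "\<sigma> \<inter> \<sigma>' \<in> ridges" "cofacets (\<sigma> \<inter> \<sigma>') = {\<sigma>, \<sigma>'}"
proof -
  have *: "\<sigma> \<in> facets" "\<sigma>' \<in> facets" "card (\<sigma> \<inter> \<sigma>') = n"
    using assms by (auto simp: flip_arc_iff)
  show ne: "\<sigma> \<noteq> \<sigma>'"
    using *(3) card_facet[OF *(1)] by auto
  show ridge: "\<sigma> \<inter> \<sigma>' \<in> ridges"
    using simplicesD(1)[OF *(1)] *(3) by (intro simplices_face[OF complex, of \<sigma>]) auto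
  show "cofacets (\<sigma> \<inter> \<sigma>') = {\<sigma>, \<sigma>'}"
  proof (rule sym, rule card_seteq)
    show "finite (cofacets (\<sigma> \<inter> \<sigma>'))"
      using finite_simplices[OF finite_X] by simp
    show "{\<sigma>, \<sigma>'} \<subseteq> cofacets (\<sigma> \<inter> \<sigma>')"
      using * by auto
    show "card (cofacets (\<sigma> \<inter> \<sigma>')) \<le> card {\<sigma>, \<sigma>'}"
      using card_cofacets[OF ridge] ne by simp
  qed
qed

text \<open>The two cofacets share the \<open>n\<close> vertices of \<open>\<tau>\<close>. With
  \<open>n + 1\<close> common vertices they would coincide, so they are adjacent.\<close>

lemma ridge_cofacets:
  assumes "\<tau> \<in> ridges"
  obtains \<sigma> \<sigma>' where "cofacets \<tau> = {\<sigma>, \<sigma>'}" "\<sigma> \<noteq> \<sigma>'"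
    "(\<sigma>, \<sigma>') \<in> parcs (flip_graph n X)" "(\<sigma>', \<sigma>) \<in> parcs (flip_graph n X)"
proof -
  obtain \<sigma> \<sigma>' where \<sigma>: "cofacets \<tau> = {\<sigma>, \<sigma>'}" "\<sigma> \<noteq> \<sigma>'"
    using card_cofacets[OF assms] by (auto simp: card_2_iff)
  then have *: "\<sigma> \<in> facets" "\<sigma>' \<in> facets" "\<tau> \<subseteq> \<sigma> \<inter> \<sigma>'"
    by auto
  have "n \<le> card (\<sigma> \<inter> \<sigma>')"
    using card_mono[OF _ *(3)] facet_finite[OF *(1)] card_ridge[OF assms] by simp
  moreover have "card (\<sigma> \<inter> \<sigma>') < Suc n"
  proof (rule ccontr)
    assume "\<not> card (\<sigma> \<inter> \<sigma>') < Suc n"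
    then have "card \<sigma> \<le> card (\<sigma> \<inter> \<sigma>')" "card \<sigma>' \<le> card (\<sigma> \<inter> \<sigma>')"
      using *(1,2) by (simp_all add: card_facet)
    then have "\<sigma> \<inter> \<sigma>' = \<sigma>" "\<sigma> \<inter> \<sigma>' = \<sigma>'"
      using *(1,2) by (simp_all add: card_seteq facet_finite)
    then show False
      using \<sigma>(2) by blast
  qed
  ultimately have "card (\<sigma> \<inter> \<sigma>') = n"
    by simp
  then show ?thesis
    using that[OF \<sigma>] * by (simp add: flip_arc_iff Int_commute)
qed

section \<open>Joins in the flip graph: construction and lower bound\<close>

lemma coboundary_facet:
  "\<sigma> \<in> facets \<Longrightarrow> \<delta> \<phi> \<sigma> = (\<Sum>\<tau> | \<tau> \<in> ridges \<and> \<tau> \<subseteq> \<sigma>. \<phi> \<tau>)"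
  and coboundary_not_facet: "\<sigma> \<notin> facets \<Longrightarrow> \<delta> \<phi> \<sigma> = 0"
  by (simp_all add: coboundary_def)

lemma \<delta>_in_cochains: "\<delta> \<phi> \<in> cochains X (int n)"
  using coboundary_in_cochains .

text \<open>The ridge \<open>u \<inter> v\<close> lies in the facets \<open>u\<close> and
  \<open>v\<close> and in no other. This is the one-arc case of a join.\<close>

lemma coboundary_indicator_flip:
  assumes "(u, v) \<in> parcs (flip_graph n X)"
  shows "\<delta> (\<lambda>\<tau>. of_bool (\<tau> = u \<inter> v)) = (\<lambda>\<sigma>. of_bool (\<sigma> = u) + of_bool (\<sigma> = v))"
proof
  fix \<sigma>
  note uv = cofacets_Int[OF assms]
  show "\<delta> (\<lambda>\<tau>. of_bool (\<tau> = u \<inter> v)) \<sigma> = of_bool (\<sigma> = u) + of_bool (\<sigma> = v)"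
  proof (cases "\<sigma> \<in> facets")
    case True
    have fin: "finite {\<tau> \<in> ridges. \<tau> \<subseteq> \<sigma>}"
      by (simp add: finite_simplices finite_X)
    have "\<delta> (\<lambda>\<tau>. of_bool (\<tau> = u \<inter> v)) \<sigma> = of_bool (u \<inter> v \<subseteq> \<sigma>)"
      using True uv(2) fin by (simp add: coboundary_facet of_bool_def sum.delta)
    also have "u \<inter> v \<subseteq> \<sigma> \<longleftrightarrow> \<sigma> = u \<or> \<sigma> = v"
    proof -
      have "\<sigma> \<in> cofacets (u \<inter> v) \<longleftrightarrow> \<sigma> \<in> {u, v}"
        by (simp only: uv(3))
      then show ?thesis
        using True by simp
    qed
    \<comment> \<open>Addition of bits is exclusive or, so this needs \<open>u\<close> and
      \<open>v\<close> to be distinct.\<close>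
    also have "of_bool (\<sigma> = u \<or> \<sigma> = v) = (of_bool (\<sigma> = u) + of_bool (\<sigma> = v) :: bit)"
      using uv(1) by simp
    finally show ?thesis .
  next
    case False
    then show ?thesis
      using assms by (auto simp: coboundary_not_facet flip_arc_iff)
  qed
qed

text \<open>The indicators of the crossed ridges are added up, and the inner facets of the walk
  cancel. Ridges crossed repeatedly may cancel too, hence only an inequality for the norm. Writing
  the ends as a sum of indicators also covers closed walks, where it is zero.\<close>

lemma walk_join:
  "flip.awalk u p v \<Longrightarrow> \<exists>\<psi>\<in>cochains X (int n - 1).
    \<delta> \<psi> = (\<lambda>\<sigma>. of_bool (\<sigma> = u) + of_bool (\<sigma> = v)) \<and> cochain_norm \<psi> \<le> length p"
proof (induction p arbitrary: u)
  case Nil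
  then have "u = v"
    by (simp add: flip.awalk_Nil_iff)
  moreover have "cochain_norm (\<lambda>_ :: 'a set. 0) \<le> length []"
    by (simp add: cochain_norm_def)
  ultimately show ?case
    using cochains_zero[of X "int n - 1"] coboundary_zero[of X "int n - 1"]
    by (intro bexI[of _ "\<lambda>_. 0"]) auto
next
  case (Cons e p)
  obtain w where e: "e = (u, w)" "(u, w) \<in> parcs (flip_graph n X)" and p: "flip.awalk w p v"
    using Cons.prems by (cases e) (auto simp: flip.awalk_Cons_iff)
  obtain \<psi> where \<psi>: "\<psi> \<in> cochains X (int n - 1)"
      "\<delta> \<psi> = (\<lambda>\<sigma>. of_bool (\<sigma> = w) + of_bool (\<sigma> = v))" "cochain_norm \<psi> \<le> length p"
    using Cons.IH[OF p] by blast
  \<comment> \<open>The indicator of the ridge crossed by the first arc.\<close>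
  let ?\<iota> = "\<lambda>\<tau>. of_bool (\<tau> = u \<inter> w)"
  have \<iota>: "?\<iota> \<in> cochains X (int n - 1)"
    using cofacets_Int(2)[OF e(2)] by (auto simp: cochains_def)
  have "cochain_norm ?\<iota> = 1"
    by (simp add: cochain_norm_def)
  then have "cochain_norm (\<lambda>\<tau>. ?\<iota> \<tau> + \<psi> \<tau>) \<le> length (e # p)"
    using cochain_norm_add_le[OF finite_X \<iota> \<psi>(1)] \<psi>(3) by simp
  moreover have "\<delta> (\<lambda>\<tau>. ?\<iota> \<tau> + \<psi> \<tau>) = (\<lambda>\<sigma>. of_bool (\<sigma> = u) + of_bool (\<sigma> = v))"
    by (simp add: coboundary_add coboundary_indicator_flip[OF e(2)] \<psi>(2) add.assoc)
  ultimately show ?case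
    using cochains_add[OF \<iota> \<psi>(1)] by blast
qed

text \<open>Induction removes two elements of \<open>T\<close> at a time and joins them by a
  shortest walk, which has at most \<open>D\<close> arcs. The factor 2 replaces a division of
  \<open>card T\<close> by 2.\<close>

lemma even_set_join:
  assumes "T \<subseteq> facets" "even (card T)"
    and D: "\<And>u v. u \<in> facets \<Longrightarrow> v \<in> facets \<Longrightarrow> flip.hop_dist u v \<le> D"
  shows "\<exists>\<psi>\<in>cochains X (int n - 1).
    \<delta> \<psi> = (\<lambda>\<sigma>. of_bool (\<sigma> \<in> T)) \<and> 2 * cochain_norm \<psi> \<le> card T * D"
  using assms(1,2)
proof (induction "card T" arbitrary: T rule: less_induct)
  case less
  have fin: "finite T"
    using finite_subset[OF less.prems(1) finite_simplices[OF finite_X]] .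
  show ?case
  proof (cases "T = {}")
    case True
    then have "\<delta> (\<lambda>_. 0) = (\<lambda>\<sigma>. of_bool (\<sigma> \<in> T))" "2 * cochain_norm (\<lambda>_ :: 'a set. 0) \<le> card T * D"
      by (simp_all add: coboundary_zero cochain_norm_def)
    then show ?thesis
      using cochains_zero by blast
  next
    case False
    then have "card T \<noteq> 0"
      using fin by simp
    moreover have "card T \<noteq> 1"
      using less.prems(2) by auto
    ultimately have "2 \<le> card T"
      by linarith
    then obtain S where "S \<subseteq> T" "card S = 2"
      by (rule obtain_subset_with_card_n)
    then obtain u v where uv: "u \<in> T" "v \<in> T" "u \<noteq> v"
      by (auto simp: card_2_iff)
    have T': "card (T - {u, v}) + 2 = card T"
      using uv fin \<open>2 \<le> card T\<close> by (simp add: card_Diff_subset)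
    then have "even (card (T - {u, v}))"
      using less.prems(2) by presburger
    moreover have "card (T - {u, v}) < card T" "T - {u, v} \<subseteq> facets"
      using T' less.prems(1) by auto
    ultimately obtain \<psi> where \<psi>: "\<psi> \<in> cochains X (int n - 1)"
        "\<delta> \<psi> = (\<lambda>\<sigma>. of_bool (\<sigma> \<in> T - {u, v}))" "2 * cochain_norm \<psi> \<le> card (T - {u, v}) * D"
      using less.hyps[of "T - {u, v}"] by blast
    have facets: "u \<in> facets" "v \<in> facets"
      using uv less.prems(1) by auto
    obtain p where p: "flip.awalk u p v" "length p = flip.hop_dist u v"
      using flip.shortest_awalk[OF flip_reachable[OF facets]] .
    obtain \<chi> where \<chi>: "\<chi> \<in> cochains X (int n - 1)"
        "\<delta> \<chi> = (\<lambda>\<sigma>. of_bool (\<sigma> = u) + of_bool (\<sigma> = v))" "cochain_norm \<chi> \<le> length p"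
      using walk_join[OF p(1)] by blast
    have "2 * cochain_norm (\<lambda>\<tau>. \<psi> \<tau> + \<chi> \<tau>) \<le> card (T - {u, v}) * D + 2 * D"
      using cochain_norm_add_le[OF finite_X \<psi>(1) \<chi>(1)] \<psi>(3) \<chi>(3) p(2) D[OF facets] by linarith
    also have "\<dots> = card T * D"
      by (simp flip: T' add: algebra_simps)
    finally have "2 * cochain_norm (\<lambda>\<tau>. \<psi> \<tau> + \<chi> \<tau>) \<le> card T * D" .
    moreover have "\<delta> (\<lambda>\<tau>. \<psi> \<tau> + \<chi> \<tau>) = (\<lambda>\<sigma>. of_bool (\<sigma> \<in> T))"
      using uv by (auto simp: coboundary_add \<psi>(2) \<chi>(2) fun_eq_iff)
    ultimately show ?thesis
      using cochains_add[OF \<psi>(1) \<chi>(1)] by blast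
  qed
qed

text \<open>Double counting of the pairs of a ridge and a facet of \<open>A\<close> above it. Modulo
  2 only ridges with exactly one cofacet in \<open>A\<close> survive, that is, the edge cut of
  \<open>A\<close>. It is applied to all facets and to balls.\<close>

lemma sum_coboundary:
  assumes "A \<subseteq> facets"
  shows "(\<Sum>\<sigma>\<in>A. \<delta> \<phi> \<sigma>) = (\<Sum>\<tau>\<in>ridges. of_nat (card (cofacets \<tau> \<inter> A)) * \<phi> \<tau>)"
proof -
  have fin: "finite A"
    using finite_subset[OF assms finite_simplices[OF finite_X]] .
  have "(\<Sum>\<sigma>\<in>A. \<delta> \<phi> \<sigma>) = (\<Sum>\<sigma>\<in>A. \<Sum>\<tau> | \<tau> \<in> ridges \<and> \<tau> \<subseteq> \<sigma>. \<phi> \<tau>)"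
    using assms by (intro sum.cong) (auto simp: coboundary_facet)
  also have "\<dots> = (\<Sum>\<tau>\<in>ridges. \<Sum>\<sigma> | \<sigma> \<in> A \<and> \<tau> \<subseteq> \<sigma>. \<phi> \<tau>)"
    using fin by (intro sum.swap_restrict) (auto simp: finite_simplices finite_X)
  also have "\<dots> = (\<Sum>\<tau>\<in>ridges. of_nat (card (cofacets \<tau> \<inter> A)) * \<phi> \<tau>)"
  proof (intro sum.cong refl)
    fix \<tau>
    have "{\<sigma>. \<sigma> \<in> A \<and> \<tau> \<subseteq> \<sigma>} = cofacets \<tau> \<inter> A"
      using assms by auto
    then show "(\<Sum>\<sigma> | \<sigma> \<in> A \<and> \<tau> \<subseteq> \<sigma>. \<phi> \<tau>) = of_nat (card (cofacets \<tau> \<inter> A)) * \<phi> \<tau>"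
      by simp
  qed
  finally show ?thesis .
qed

text \<open>The handshake lemma: summed over all facets, every ridge is counted twice.\<close>

lemma even_cochain_norm_coboundary: "even (cochain_norm (\<delta> \<phi>))"
proof -
  have "{\<sigma>. \<delta> \<phi> \<sigma> \<noteq> 0} = {\<sigma> \<in> facets. \<delta> \<phi> \<sigma> \<noteq> 0}"
    using cochain_support_subset[OF \<delta>_in_cochains] by auto
  then have "(of_nat (cochain_norm (\<delta> \<phi>)) :: bit) = (\<Sum>\<sigma>\<in>facets. \<delta> \<phi> \<sigma>)"
    by (simp add: cochain_norm_def sum_bit_eq_of_nat_card finite_simplices finite_X)
  also have "\<dots> = (\<Sum>\<tau>\<in>ridges. of_nat (card (cofacets \<tau> \<inter> facets)) * \<phi> \<tau>)"
    by (rule sum_coboundary) simp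
  also have "\<dots> = 0"
  proof (intro sum.neutral ballI)
    fix \<tau> assume "\<tau> \<in> ridges"
    moreover have "cofacets \<tau> \<inter> facets = cofacets \<tau>"
      by auto
    ultimately have "card (cofacets \<tau> \<inter> facets) = 2"
      using card_cofacets by simp
    then show "of_nat (card (cofacets \<tau> \<inter> facets)) * \<phi> \<tau> = 0"
      by simp
  qed
  finally show ?thesis
    by (simp add: of_nat_bit_eq_0_iff)
qed

text \<open>For each \<open>k\<close> below the distance, the ball of radius \<open>k\<close> around
  \<open>u\<close> separates \<open>u\<close> from \<open>v\<close>. Its cut must then meet the
  support of \<open>\<chi>\<close>, and different radii yield different ridges.\<close>

lemma hop_dist_le_cochain_norm:
  assumes "\<chi> \<in> cochains X (int n - 1)" "u \<in> facets" "v \<in> facets"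
    and \<chi>: "\<delta> \<chi> = (\<lambda>\<sigma>. of_bool (\<sigma> = u) + of_bool (\<sigma> = v))"
  shows "flip.hop_dist u v \<le> cochain_norm \<chi>"
proof -
  let ?d = "flip.hop_dist u"
  \<comment> \<open>For a ridge between the levels \<open>k\<close> and \<open>k + 1\<close> this
    returns \<open>k\<close>, so \<open>lev\<close> maps the support onto all levels below the
    distance.\<close>
  define lev where "lev \<tau> = Min (?d ` cofacets \<tau>)" for \<tau>
  have "{..<?d v} \<subseteq> lev ` {\<tau>. \<chi> \<tau> \<noteq> 0}"
  proof
    fix k assume "k \<in> {..<?d v}"
    then have k: "k < ?d v"
      by simp
    let ?A = "{\<sigma> \<in> facets. ?d \<sigma> \<le> k}"
    have u: "?d u = 0"
      using assms(2) flip.hop_dist_self by simp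
    have "u \<noteq> v"
      using k u by auto
    \<comment> \<open>As \<open>k < ?d v\<close>, the facet \<open>v\<close> lies outside the ball
      and its indicator vanishes there.\<close>
    have "(\<Sum>\<sigma>\<in>?A. \<delta> \<chi> \<sigma>) = (\<Sum>\<sigma>\<in>?A. of_bool (\<sigma> = u))"
      using k by (intro sum.cong) (auto simp: \<chi>)
    also have "\<dots> = 1"
      using assms(2) u by (simp add: of_bool_def finite_simplices finite_X)
    finally have "(\<Sum>\<tau>\<in>ridges. of_nat (card (cofacets \<tau> \<inter> ?A)) * \<chi> \<tau>) \<noteq> 0"
      using sum_coboundary[of ?A \<chi>] by simp
    then obtain \<tau> where \<tau>: "\<tau> \<in> ridges" "of_nat (card (cofacets \<tau> \<inter> ?A)) * \<chi> \<tau> \<noteq> 0"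
      by (rule sum.not_neutral_contains_not_neutral)
    then have "\<chi> \<tau> \<noteq> 0" and "odd (card (cofacets \<tau> \<inter> ?A))"
      by (auto simp: of_nat_bit_eq_0_iff simp del: bit_not_zero_iff)
    obtain \<sigma> \<sigma>' where \<sigma>: "cofacets \<tau> = {\<sigma>, \<sigma>'}" "\<sigma> \<noteq> \<sigma>'"
        "(\<sigma>, \<sigma>') \<in> parcs (flip_graph n X)" "(\<sigma>', \<sigma>) \<in> parcs (flip_graph n X)"
      using ridge_cofacets[OF \<tau>(1)] .
    have facets: "\<sigma> \<in> facets" "\<sigma>' \<in> facets"
      using \<sigma>(1) by auto
    \<comment> \<open>Both orientations of the arc are used: the two levels differ by at most one.
      As exactly one end is in the ball, the levels are \<open>k\<close> and
      \<open>k + 1\<close>.\<close>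
    have "?d \<sigma>' \<le> Suc (?d \<sigma>)"
      using flip_reachable[OF assms(2) facets(1)] \<sigma>(3) by (rule flip.hop_dist_arc) simp_all
    moreover have "?d \<sigma> \<le> Suc (?d \<sigma>')"
      using flip_reachable[OF assms(2) facets(2)] \<sigma>(4) by (rule flip.hop_dist_arc) simp_all
    moreover have "?d \<sigma> \<le> k \<longleftrightarrow> \<not> ?d \<sigma>' \<le> k"
    proof (rule ccontr)
      assume "\<not> (?d \<sigma> \<le> k \<longleftrightarrow> \<not> ?d \<sigma>' \<le> k)"
      then have "{\<sigma>, \<sigma>'} \<inter> ?A = {\<sigma>, \<sigma>'} \<or> {\<sigma>, \<sigma>'} \<inter> ?A = {}"
        using facets by auto
      moreover have "card {\<sigma>, \<sigma>'} = 2"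
        using \<sigma>(2) by simp
      ultimately have "even (card ({\<sigma>, \<sigma>'} \<inter> ?A))"
        by (elim disjE) (simp_all only: card.empty even_zero dvd_refl)
      then show False
        using \<open>odd (card (cofacets \<tau> \<inter> ?A))\<close> unfolding \<sigma>(1) by blast
    qed
    ultimately have "min (?d \<sigma>) (?d \<sigma>') = k"
      by linarith
    then have "lev \<tau> = k"
      by (simp only: lev_def \<sigma>(1)) simp
    then show "k \<in> lev ` {\<tau>. \<chi> \<tau> \<noteq> 0}"
      using \<open>\<chi> \<tau> \<noteq> 0\<close> by blast
  qed
  then have "card {..<?d v} \<le> card {\<tau>. \<chi> \<tau> \<noteq> 0}"
    by (rule surj_card_le[OF finite_cochain_support[OF finite_X assms(1)]])
  then show ?thesis
    by (simp add: cochain_norm_def)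
qed

section \<open>The diameter and the expansion constant\<close>

lemma flip_arc_exists: "\<exists>\<sigma> \<sigma>'. (\<sigma>, \<sigma>') \<in> parcs (flip_graph n X)"
proof -
  obtain \<sigma> where \<sigma>: "\<sigma> \<in> facets"
    using complex pure by (metis all_not_in_conv simplicial_complex_def)
  then have "n \<le> card \<sigma>"
    by (simp add: card_facet)
  \<comment> \<open>Dropping one vertex from a facet leaves a ridge, and its two cofacets form an
    arc.\<close>
  then obtain \<tau> where "\<tau> \<subseteq> \<sigma>" "card \<tau> = n"
    by (rule obtain_subset_with_card_n)
  then have "\<tau> \<in> ridges"
    using simplicesD(1)[OF \<sigma>] by (intro simplices_face[OF complex, of \<sigma>]) auto
  then show ?thesis
    using ridge_cofacets by metis
qed

text \<open>There are finitely many pairs of facets, all at finite distance, so the supremum is a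
  maximum.\<close>

lemma diameter_attained:
  obtains u v where "u \<in> facets" "v \<in> facets" "flip.hop_dist u v > 0"
    "\<And>u' v'. u' \<in> facets \<Longrightarrow> v' \<in> facets \<Longrightarrow> flip.hop_dist u' v' \<le> flip.hop_dist u v"
    "graph_diameter (with_proj (flip_graph n X)) = ereal (real (flip.hop_dist u v))"
proof -
  let ?S = "(\<lambda>(u, v). flip.hop_dist u v) ` (facets \<times> facets)"
  \<comment> \<open>Adjacent facets are distinct, which makes the maximal distance positive.\<close>
  obtain \<sigma> \<sigma>' where arc: "(\<sigma>, \<sigma>') \<in> parcs (flip_graph n X)"
    using flip_arc_exists by blast
  then have \<sigma>: "\<sigma> \<in> facets" "\<sigma>' \<in> facets" "\<sigma> \<noteq> \<sigma>'"
    using cofacets_Int(1)[OF arc] by (auto simp: flip_arc_iff)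
  have fin: "finite ?S"
    by (simp add: finite_simplices finite_X)
  have "Max ?S \<in> ?S"
    using fin \<sigma> by (intro Max_in) auto
  then obtain u v where uv: "u \<in> facets" "v \<in> facets" "flip.hop_dist u v = Max ?S"
    by auto
  have max: "flip.hop_dist u' v' \<le> flip.hop_dist u v" if "u' \<in> facets" "v' \<in> facets" for u' v'
    unfolding uv(3) using that by (intro Max_ge[OF fin]) auto
  have "flip.hop_dist \<sigma> \<sigma>' > 0"
    using flip.hop_dist_eq_0_imp_eq[OF flip_reachable[OF \<sigma>(1,2)]] \<sigma>(3) by auto
  then have pos: "flip.hop_dist u v > 0"
    using max[OF \<sigma>(1,2)] by simp
  have \<mu>: "flip.\<mu> (\<lambda>_. 1) u' v' = ereal (real (flip.hop_dist u' v'))"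
    if "u' \<in> facets" "v' \<in> facets" for u' v'
    using flip.\<mu>_one_eq_hop_dist[OF flip_reachable[OF that]] .
  have "graph_diameter (with_proj (flip_graph n X)) = ereal (real (flip.hop_dist u v))"
  proof (rule antisym)
    show "graph_diameter (with_proj (flip_graph n X)) \<le> ereal (real (flip.hop_dist u v))"
      unfolding graph_diameter_def by (intro SUP_least) (auto simp: \<mu> max)
    have "ereal (real (flip.hop_dist u v)) = flip.\<mu> (\<lambda>_. 1) u v"
      using uv \<mu> by simp
    also have "\<dots> \<le> graph_diameter (with_proj (flip_graph n X))"
      unfolding graph_diameter_def
      by (intro SUP_upper2[of u] SUP_upper2[of v]) (use uv in auto)
    finally show "ereal (real (flip.hop_dist u v)) \<le> graph_diameter (with_proj (flip_graph n X))" .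
  qed
  then show ?thesis
    using that[OF uv(1,2) pos max] by blast
qed

text \<open>The bound \<open>lower\<close> holds for every admissible cochain, and the join along a
  shortest walk from \<open>u\<close> to \<open>v\<close> attains it.\<close>

lemma expansion_eq:
  assumes H: "trivial_group (cohomology X (int n - 1))"
    and uv: "u \<in> facets" "v \<in> facets" "flip.hop_dist u v > 0"
    and max: "\<And>u' v'. u' \<in> facets \<Longrightarrow> v' \<in> facets \<Longrightarrow> flip.hop_dist u' v' \<le> flip.hop_dist u v"
  shows "coboundary_expansion X (int n - 1) = 2 / real (flip.hop_dist u v)"
proof -
  let ?k = "int n - 1" and ?D = "flip.hop_dist u v"
  let ?q = "\<lambda>\<phi>. real (cochain_norm (\<delta> \<phi>)) / real (csy_norm X ?k \<phi>)"
  have lower: "2 / real ?D \<le> ?q \<phi>" if \<phi>: "\<phi> \<in> cochains X ?k - coboundaries X ?k" for \<phi>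
  proof -
    let ?T = "{\<sigma>. \<delta> \<phi> \<sigma> \<noteq> 0}"
    have "?T \<subseteq> facets"
      using cochain_support_subset[OF \<delta>_in_cochains] .
    moreover have "even (card ?T)"
      using even_cochain_norm_coboundary[of \<phi>] by (simp add: cochain_norm_def)
    ultimately obtain \<psi> where \<psi>: "\<psi> \<in> cochains X ?k"
        "\<delta> \<psi> = (\<lambda>\<sigma>. of_bool (\<sigma> \<in> ?T))" "2 * cochain_norm \<psi> \<le> card ?T * ?D"
      using even_set_join[of ?T ?D] max by blast
    have "\<delta> \<psi> = \<delta> \<phi>"
      unfolding \<psi>(2) by (auto simp: fun_eq_iff of_bool_def)
    \<comment> \<open>Equal coboundaries make the sum a cocycle, hence a coboundary. So
      \<open>\<psi>\<close> competes in the minimum that defines the cosystolic norm of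
      \<open>\<phi>\<close>.\<close>
    then have "\<delta> (\<lambda>\<tau>. \<phi> \<tau> + \<psi> \<tau>) = (\<lambda>_. 0)"
      by (simp add: coboundary_add)
    then have "(\<lambda>\<tau>. \<phi> \<tau> + \<psi> \<tau>) \<in> coboundaries X ?k"
      using cocycle_in_coboundaries[OF H] cochains_add[OF _ \<psi>(1)] \<phi> by blast
    then obtain \<eta> where \<eta>: "\<eta> \<in> cochains X (?k - 1)"
        "(\<lambda>\<tau>. \<phi> \<tau> + \<psi> \<tau>) = coboundary X (?k - 1) \<eta>"
      by (auto simp: coboundaries_def)
    have "\<phi> \<tau> + coboundary X (?k - 1) \<eta> \<tau> = \<psi> \<tau>" for \<tau>
      using bit_add_self_left[of "\<phi> \<tau>" "\<psi> \<tau>"] fun_cong[OF \<eta>(2), of \<tau>] by simp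
    then have "csy_norm X ?k \<phi> \<le> cochain_norm \<psi>"
      using csy_norm_le[OF finite_X \<eta>(1), of \<phi>] by simp
    then have "2 * csy_norm X ?k \<phi> \<le> cochain_norm (\<delta> \<phi>) * ?D"
      using \<psi>(3) unfolding cochain_norm_def by linarith
    then have "real (2 * csy_norm X ?k \<phi>) \<le> real (cochain_norm (\<delta> \<phi>) * ?D)"
      by (simp only: of_nat_le_iff)
    moreover have "csy_norm X ?k \<phi> > 0"
      using csy_norm_pos[OF finite_X] \<phi> by blast
    ultimately show ?thesis
      using uv(3) by (simp add: field_simps)
  qed
  obtain p where p: "flip.awalk u p v" "length p = ?D"
    using flip.shortest_awalk[OF flip_reachable[OF uv(1,2)]] .
  obtain \<psi> where \<psi>: "\<psi> \<in> cochains X ?k" "\<delta> \<psi> = (\<lambda>\<sigma>. of_bool (\<sigma> = u) + of_bool (\<sigma> = v))"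
    using walk_join[OF p(1)] by blast
  have "u \<noteq> v"
    using uv by auto
  then have "{\<sigma>. \<delta> \<psi> \<sigma> \<noteq> 0} = {u, v}"
    by (auto simp: \<psi>(2))
  then have norm: "cochain_norm (\<delta> \<psi>) = 2"
    using \<open>u \<noteq> v\<close> by (simp add: cochain_norm_def)
  \<comment> \<open>Its coboundary is nonzero, so \<open>\<psi>\<close> is not even a
    cocycle.\<close>
  have "\<psi> \<notin> coboundaries X ?k"
  proof
    assume "\<psi> \<in> coboundaries X ?k"
    then have "cochain_norm (\<delta> \<psi>) = 0"
      using coboundary_of_coboundaries[OF finite_X complex] by (simp add: cochain_norm_def)
    then show False
      using norm by simp
  qed
  then have mem: "\<psi> \<in> cochains X ?k - coboundaries X ?k"
    using \<psi>(1) by blast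
  have "?D \<le> csy_norm X ?k \<psi>"
  proof -
    obtain \<eta> where \<eta>: "\<eta> \<in> cochains X (?k - 1)"
        "csy_norm X ?k \<psi> = cochain_norm (\<lambda>\<sigma>. \<psi> \<sigma> + coboundary X (?k - 1) \<eta> \<sigma>)"
      using csy_norm_attained[OF finite_X] .
    \<comment> \<open>Adding a coboundary does not change \<open>\<delta> \<psi>\<close>, so the
      minimiser is again a join of \<open>u\<close> and \<open>v\<close> and has at least
      \<open>?D\<close> ridges.\<close>
    have "\<delta> (coboundary X (?k - 1) \<eta>) = (\<lambda>_. 0)"
      using coboundary_coboundary[OF finite_X complex, of "?k - 1"] by simp
    then have "\<delta> (\<lambda>\<sigma>. \<psi> \<sigma> + coboundary X (?k - 1) \<eta> \<sigma>) = \<delta> \<psi>"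
      by (simp add: coboundary_add)
    then show ?thesis
      unfolding \<eta>(2) using \<psi> uv(1,2)
      by (intro hop_dist_le_cochain_norm cochains_add coboundary_in_cochains) auto
  qed
  then have "?q \<psi> \<le> 2 / real ?D"
    using norm uv(3) by (simp add: frac_le)
  with lower[OF mem] have q: "2 / real ?D = ?q \<psi>"
    by (rule antisym)
  show ?thesis
    unfolding coboundary_expansion_def
  proof (rule Min_eqI)
    show "finite (?q ` (cochains X ?k - coboundaries X ?k))"
      using finite_cochains[OF finite_X] by blast
    show "2 / real ?D \<le> y" if "y \<in> ?q ` (cochains X ?k - coboundaries X ?k)" for y
      using that lower by blast
    show "2 / real ?D \<in> ?q ` (cochains X ?k - coboundaries X ?k)"
      using mem unfolding q by (rule imageI)
  qed
qed

end

theorem theorem3p3: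
  fixes X :: "'a set set" and n :: nat
  assumes "pseudomanifold n X"
    and "trivial_group (cohomology X (int n - 1))"
  shows "ereal (coboundary_expansion X (int n - 1))
           = 2 / graph_diameter (with_proj (flip_graph n X))"
proof -
  interpret pseudomanifold_complex n X
    using assms(1) by unfold_locales
  obtain u v where uv: "u \<in> facets" "v \<in> facets" "flip.hop_dist u v > 0"
      "\<And>u' v'. u' \<in> facets \<Longrightarrow> v' \<in> facets \<Longrightarrow> flip.hop_dist u' v' \<le> flip.hop_dist u v"
      "graph_diameter (with_proj (flip_graph n X)) = ereal (real (flip.hop_dist u v))"
    using diameter_attained by metis
  \<comment> \<open>The diameter is a positive real number here, so the division of extended reals
    is that of the reals.\<close>
  then show ?thesis
    using expansion_eq[OF assms(2) uv(1-4)] by simp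
qed

end
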